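(* Let $G$ be a locally finite infinite graph, $k \in \mathbb{N}$ and $q \in \mathbb{Q}$. (i) If $\delta(G) \geq k$ and $\delta^-(\omega) \geq k$ for every end $\omega$ of $G$, then $G$ has a finite subgraph of minimum degree $\geq k$. (ii) If there is a finite set $S_0 \subseteq V(G)$ such that $d_G(S) \geq q$ for every finite set $S \subseteq V(G)$ with $S_0 \subseteq S$, and $d^-(\omega) > q$ for every end $\omega$ of $G$, then $G$ has a finite subgraph of average degree $> q$.
   Context: All graphs are locally finite. An end of $G$ is an equivalence class of rays (one-way infinite paths) of $G$, two rays being equivalent if no finite vertex set separates them. For a subgraph or vertex set $U$ of $G$, its vertex boundary is $V^+(U) := N(G-U) \subseteq U$, the set of vertices of $U$ having a neighbour outside $U$. For a finite vertex set $U$, $d_G(U) := \sum_{v\in U} d_G(v)/|U|$. A region of $G$ is a connected induced subgraph $C$ with finite vertex boundary; then $S := N(C)$ (the set of vertices outside $C$ with a neighbour in $C$) is finite, and one writes $G[S,C] := G[S \cup V^+(C)]$ (induced subgraph). The minimum out-degree of $C$ is $\delta_G^+(C) := \min_{v\in V^+(C)} d_{G[S,C]}(v)$ and its average out-degree is $d_G^+(C) := d_{G[S,C]}(V^+(C))$, i.e. the average over $v \in V^+(C)$ of $d_{G[S,C]}(v)$. A sequence $C_0 \supseteq C_1 \supseteq \dots$ of regions is a defining sequence for an end $\omega$ if every $C_n$ contains a ray from $\omega$ and $\bigcap_n C_n = \emptyset$. Then $\delta^-(\omega) := \inf \lim_{n\to\infty} \delta_G^+(C_n)$ and $d^-(\omega)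 := \inf \lim_{n\to\infty} d_G^+(C_n)$, where the infima are over all defining sequences of $\omega$ for which the limit exists (the value $\infty$ allowed). The paper's hypothesis in (ii) reads "$d_G(S)\ge q$ for every large enough finite set $S$", which it explains as meaning that all finite $S$ containing some given finite set $S_0$ satisfy it.
   Formalization: Part (ii) additionally assumes that G has at least one end; without this it fails, e.g. for a disjoint union of infinitely many triangles with q = 2, and only graphs all of whose components are finite are excluded. *)

theory Defs
  imports Complex_Main "HOL-Library.Extended_Real"
begin

record 'a graph =
  verts :: "'a set"
  edges :: "'a set set"

definition simple_graph :: "'a graph \<Rightarrow> bool" where
  "simple_graph G \<longleftrightarrow> (\<forall>e\<in>edges G. e \<subseteq> verts G \<and> card e = 2)"

definition subgraph :: "'a graph \<Rightarrow> 'a graph \<Rightarrow> bool" where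
  "subgraph H G \<longleftrightarrow> simple_graph H \<and> verts H \<subseteq> verts G \<and> edges H \<subseteq> edges G"

definition induced :: "'a graph \<Rightarrow> 'a set \<Rightarrow> 'a graph" where
  "induced G U = \<lparr>verts = verts G \<inter> U, edges = {e \<in> edges G. e \<subseteq> U}\<rparr>"

definition adjacent :: "'a graph \<Rightarrow> 'a \<Rightarrow> 'a \<Rightarrow> bool" where
  "adjacent G u v \<longleftrightarrow> {u, v} \<in> edges G"

definition degree :: "'a graph \<Rightarrow> 'a \<Rightarrow> nat" where
  "degree G v = card {u. adjacent G v u}"

definition locally_finite :: "'a graph \<Rightarrow> bool" where
  "locally_finite G \<longleftrightarrow> (\<forall>v\<in>verts G. finite {u. adjacent G v u})"

text \<open>On a nonempty set of natural numbers the infimum is the minimum.\<close>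

definition min_degree :: "'a graph \<Rightarrow> nat" where
  "min_degree G = (INF v\<in>verts G. degree G v)"

definition avg_degree :: "'a graph \<Rightarrow> 'a set \<Rightarrow> real" where
  "avg_degree G U = (\<Sum>v\<in>U. real (degree G v)) / real (card U)"

definition connected_graph :: "'a graph \<Rightarrow> bool" where
  "connected_graph G \<longleftrightarrow> verts G \<noteq> {} \<and> (\<forall>u\<in>verts G. \<forall>v\<in>verts G. (adjacent G)\<^sup>*\<^sup>* u v)"

text \<open>A ray is represented by the enumeration of its vertices from its unique starting vertex.\<close>

definition rays :: "'a graph \<Rightarrow> (nat \<Rightarrow> 'a) set" where
  "rays G = {r. inj r \<and> range r \<subseteq> verts G \<and> (\<forall>n. adjacent G (r n) (r (Suc n)))}"

text \<open>\<open>X\<close> separates \<open>A\<close> from \<open>B\<close> if every path from \<open>A\<close> to \<open>B\<close> meets \<open>X\<close>. A path of length zero,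
  at a vertex of \<open>A \<inter> B\<close>, counts.\<close>

definition separates :: "'a graph \<Rightarrow> 'a set \<Rightarrow> 'a set \<Rightarrow> 'a set \<Rightarrow> bool" where
  "separates G X A B \<longleftrightarrow>
    \<not> (\<exists>a\<in>A - X. \<exists>b\<in>B - X. (adjacent (induced G (verts G - X)))\<^sup>*\<^sup>* a b)"

definition ray_equiv :: "'a graph \<Rightarrow> ((nat \<Rightarrow> 'a) \<times> (nat \<Rightarrow> 'a)) set" where
  "ray_equiv G = {(r, s). r \<in> rays G \<and> s \<in> rays G \<and>
    (\<forall>X. X \<subseteq> verts G \<and> finite X \<longrightarrow> \<not> separates G X (range r) (range s))}"

text \<open>A connected infinite locally finite graph has an end, but an infinite graph all of whose
  components are finite has none.\<close>

definition ends :: "'a graph \<Rightarrow> (nat \<Rightarrow> 'a) set set" where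
  "ends G = rays G // ray_equiv G"

definition nbhd :: "'a graph \<Rightarrow> 'a set \<Rightarrow> 'a set" where
  "nbhd G U = {v \<in> verts G - U. \<exists>u\<in>U. adjacent G u v}"

text \<open>The vertex boundary \<open>V\<^sup>+(U) = N(G - U)\<close>.\<close>

definition boundary :: "'a graph \<Rightarrow> 'a set \<Rightarrow> 'a set" where
  "boundary G U = nbhd G (verts G - U)"

text \<open>Regions are induced subgraphs, so they are identified with their vertex sets.\<close>

definition region :: "'a graph \<Rightarrow> 'a set \<Rightarrow> bool" where
  "region G C \<longleftrightarrow> C \<subseteq> verts G \<and> connected_graph (induced G C) \<and> finite (boundary G C)"

text \<open>The graph \<open>G[S, C] = G[S \<union> V\<^sup>+(C)]\<close> with \<open>S = N(C)\<close>.\<close>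

definition out_graph :: "'a graph \<Rightarrow> 'a set \<Rightarrow> 'a graph" where
  "out_graph G C = induced G (nbhd G C \<union> boundary G C)"

text \<open>The next two notions are meaningful only if the boundary of \<open>C\<close> is nonempty, that is, if the
  region \<open>C\<close> is not a whole component of \<open>G\<close>. In a defining sequence of an end this holds from some
  index on, so the limits below do not depend on the values at an empty boundary.\<close>

definition min_out_degree :: "'a graph \<Rightarrow> 'a set \<Rightarrow> nat" where
  "min_out_degree G C = (INF v\<in>boundary G C. degree (out_graph G C) v)"

definition avg_out_degree :: "'a graph \<Rightarrow> 'a set \<Rightarrow> real" where
  "avg_out_degree G C = avg_degree (out_graph G C) (boundary G C)"

definition defining_sequence :: "'a graph \<Rightarrow> (nat \<Rightarrow> 'a) set \<Rightarrow> (nat \<Rightarrow> 'a set) \<Rightarrow> bool" where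
  "defining_sequence G \<omega> C \<longleftrightarrow>
    (\<forall>n. region G (C n)) \<and> (\<forall>n. C (Suc n) \<subseteq> C n) \<and>
    (\<forall>n. \<exists>r\<in>\<omega>. range r \<subseteq> C n) \<and> (\<Inter>n. C n) = {}"

definition end_min_degree :: "'a graph \<Rightarrow> (nat \<Rightarrow> 'a) set \<Rightarrow> ereal" where
  "end_min_degree G \<omega> = Inf {l. \<exists>C. defining_sequence G \<omega> C \<and>
    (\<lambda>n. ereal (real (min_out_degree G (C n)))) \<longlonglongrightarrow> l}"

definition end_avg_degree :: "'a graph \<Rightarrow> (nat \<Rightarrow> 'a) set \<Rightarrow> ereal" where
  "end_avg_degree G \<omega> = Inf {l. \<exists>C. defining_sequence G \<omega> C \<and>
    (\<lambda>n. ereal (avg_out_degree G (C n))) \<longlonglongrightarrow> l}"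

end

theory Submission imports Defs "HOL-Library.Disjoint_Sets"
begin

text \<open>
  Fix a finite vertex set and let \<open>B\<^sub>n\<close> be the ball of radius \<open>n\<close> around it. Call a component of
  some \<open>G - B\<^sub>n\<close> good if its out-degree is as large as required, and let \<open>X\<close> be the set of the
  vertices in the union of all the \<open>B\<^sub>n\<close> that lie in no good component. If \<open>X\<close> is infinite, a
  Koenig argument yields a geodesic ray such that the component of \<open>G - B\<^sub>n\<close> containing its tail
  meets \<open>X\<close>, and hence is not good, for every \<open>n\<close>. These components form a defining sequence of the
  end of the ray, which therefore has small degree. So \<open>X\<close> is finite. Since components of
  \<open>G - B\<^sub>m\<close> and \<open>G - B\<^sub>n\<close> are nested or disjoint, the neighbourhood of \<open>X\<close> is the disjoint union of the
  boundaries of the maximal good components. Hence in the finite graph \<open>G[X \<union> N(X)]\<close> the vertices of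
  \<open>X\<close> keep all their neighbours, and those of \<open>N(X)\<close> have at least their out-degree.
  For the average degree, take a set containing \<open>S\<^sub>0\<close> as the fixed vertex set, so that the average
  over \<open>X\<close> is at least \<open>q\<close>; the average over each boundary exceeds \<open>q\<close>.
\<close>

section \<open>Adjacency, limits along defining sequences, and tails of rays\<close>

lemma adjacent_induced:
  "adjacent (induced G U) u v \<longleftrightarrow> adjacent G u v \<and> u \<in> U \<and> v \<in> U"
  by (auto simp: adjacent_def induced_def)

lemma adjacent_sym: "adjacent G u v \<longleftrightarrow> adjacent G v u"
  by (simp add: adjacent_def insert_commute)

lemma rtranclp_adjacent_sym: "(adjacent G)\<^sup>*\<^sup>* u v \<Longrightarrow> (adjacent G)\<^sup>*\<^sup>* v u"
  by (metis (mono_tags, lifting) adjacent_sym symp_def symp_rtranclp)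

lemma boundary_subset: "boundary G C \<subseteq> C"
  by (auto simp: boundary_def nbhd_def)

text \<open>This permits passing to a subsequence along which the out-degrees converge. The
  intersection stays empty because \<open>n \<le> \<sigma> n\<close> and the regions
  decrease.\<close>

lemma defining_sequence_subseq:
  assumes "defining_sequence G \<omega> C" "strict_mono \<sigma>"
  shows "defining_sequence G \<omega> (C \<circ> \<sigma>)"
proof -
  have anti: "decseq C"
    using assms(1) by (auto simp: defining_sequence_def intro: decseq_SucI)
  have "C (\<sigma> (Suc n)) \<subseteq> C (\<sigma> n)" for n
    by (rule decseqD[OF anti]) (use assms(2) in \<open>simp add: strict_mono_less_eq\<close>)
  moreover have "(\<Inter>n. C (\<sigma> n)) \<subseteq> (\<Inter>n. C n)"
    using decseqD[OF anti seq_suble[OF assms(2)]] by blast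
  ultimately show ?thesis
    using assms(1) unfolding defining_sequence_def by auto
qed

text \<open>The infimum ranges only over sequences whose limit exists, and \<open>C\<close> need not
  be one of them. By compactness of the extended reals some subsequence is, and its limit inherits
  the bound.\<close>

lemma Inf_limits_le:
  fixes f :: "'a set \<Rightarrow> ereal"
  assumes C: "defining_sequence G \<omega> C" and le: "\<And>n. f (C n) \<le> b"
  shows "Inf {l. \<exists>C. defining_sequence G \<omega> C \<and> (\<lambda>n. f (C n)) \<longlonglongrightarrow> l} \<le> b"
proof -
  obtain l \<sigma> where \<sigma>: "strict_mono \<sigma>" and l: "((\<lambda>n. f (C n)) \<circ> \<sigma>) \<longlonglongrightarrow> l"
    using compact_complete_linorder[of "\<lambda>n. f (C n)"] by blast
  have "l \<le> b"
    by (rule LIMSEQ_le_const2[OF l]) (simp add: le)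
  moreover have "(\<lambda>n. f ((C \<circ> \<sigma>) n)) \<longlonglongrightarrow> l"
    using l by (simp add: o_def)
  ultimately show ?thesis
    using defining_sequence_subseq[OF C \<sigma>] by (blast intro: Inf_lower2)
qed

text \<open>Deleting a finite set leaves a vertex of the tail, and that vertex is a path of length
  zero between the two rays.\<close>

lemma ray_equiv_tail:
  assumes r: "r \<in> rays G"
  shows "(r, \<lambda>i. r (i + n)) \<in> ray_equiv G"
proof -
  have inj: "inj r" using r by (simp add: rays_def)
  have tail: "(\<lambda>i. r (i + n)) \<in> rays G"
    using r by (auto simp: rays_def inj_eq intro!: injI)
  have "\<not> separates G X (range r) (range (\<lambda>i. r (i + n)))" if "finite X" for X
  proof -
    have "infinite (range (\<lambda>i. r (i + n)))"
      using tail by (simp add: rays_def range_inj_infinite)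
    then have "\<not> range (\<lambda>i. r (i + n)) \<subseteq> X" using that finite_subset by blast
    then obtain i where "r (i + n) \<notin> X" by blast
    then show ?thesis
      unfolding separates_def by blast
  qed
  then show ?thesis using r tail by (simp add: ray_equiv_def)
qed

lemma subgraph_induced: "simple_graph G \<Longrightarrow> subgraph (induced G U) G"
  by (auto simp: subgraph_def simple_graph_def induced_def)

section \<open>Neighbourhoods, induced degrees, and components of \<open>G - X\<close>\<close>

locale locally_finite_graph =
  fixes G :: "'a graph"
  assumes simple: "simple_graph G" and locally_finite: "locally_finite G"
begin

lemma adjacent_verts: "adjacent G u v \<Longrightarrow> u \<in> verts G \<and> v \<in> verts G"
  using simple by (auto simp: simple_graph_def adjacent_def)

lemma finite_neighbours: "finite {v. adjacent G u v}"
proof (cases "u \<in> verts G")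
  case False
  then have "{v. adjacent G u v} = {}" using adjacent_verts by blast
  then show ?thesis by simp
qed (use locally_finite in \<open>simp add: locally_finite_def\<close>)

lemma finite_nbhd: "finite U \<Longrightarrow> finite (nbhd G U)"
  by (rule finite_subset[of _ "\<Union>u\<in>U. {v. adjacent G u v}"])
    (auto simp: nbhd_def finite_neighbours)

lemma degree_induced_mono:
  assumes "U \<subseteq> W"
  shows "degree (induced G U) v \<le> degree (induced G W) v"
  unfolding degree_def using assms
  by (intro card_mono finite_subset[OF _ finite_neighbours[of v]]) (auto simp: adjacent_induced)

lemma degree_induced_nbhd:
  assumes "v \<in> X"
  shows "degree (induced G (X \<union> nbhd G X)) v = degree G v"
proof -
  have "adjacent (induced G (X \<union> nbhd G X)) v u \<longleftrightarrow> adjacent G v u" for u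
    using assms adjacent_verts by (auto simp: adjacent_induced nbhd_def)
  then show ?thesis by (simp add: degree_def)
qed

text \<open>Started outside \<open>verts G - X\<close> the walk cannot move and the value is
  \<open>{v}\<close>, so this is a component of \<open>G - X\<close> only for
  \<open>v \<in> verts G - X\<close>.\<close>

definition component :: "'a set \<Rightarrow> 'a \<Rightarrow> 'a set" where
  "component X v = {u. (adjacent (induced G (verts G - X)))\<^sup>*\<^sup>* v u}"

lemma component_refl: "v \<in> component X v"
  by (simp add: component_def)

lemma component_subset:
  assumes "v \<in> verts G - X"
  shows "component X v \<subseteq> verts G - X"
proof
  fix u assume "u \<in> component X v"
  then have "(adjacent (induced G (verts G - X)))\<^sup>*\<^sup>* v u" by (simp add: component_def)
  then show "u \<in> verts G - X"
    by (induction rule: rtranclp_induct) (use assms in \<open>auto simp: adjacent_induced\<close>)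
qed

lemma component_eq:
  assumes "u \<in> component X v"
  shows "component X u = component X v"
proof -
  have vu: "(adjacent (induced G (verts G - X)))\<^sup>*\<^sup>* v u"
    using assms by (simp add: component_def)
  show ?thesis
    using rtranclp_trans[OF vu] rtranclp_trans[OF rtranclp_adjacent_sym[OF vu]]
    by (auto simp: component_def)
qed

lemma component_antimono:
  assumes "X \<subseteq> Y"
  shows "component Y v \<subseteq> component X v"
  unfolding component_def
  by (rule Collect_mono, intro impI, erule rtranclp_mono[THEN predicate2D, rotated])
    (use assms in \<open>auto simp: adjacent_induced\<close>)

lemma component_step:
  assumes "u \<in> component X v" "adjacent G u w" "u \<notin> X" "w \<notin> X"
  shows "w \<in> component X v"
proof -
  have "adjacent (induced G (verts G - X)) u w"
    using assms adjacent_verts by (auto simp: adjacent_induced)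
  then show ?thesis using assms(1) by (simp add: component_def)
qed

lemma nbhd_component:
  assumes "v \<in> verts G - X"
  shows "nbhd G (component X v) \<subseteq> X"
  using component_subset[OF assms] component_step unfolding nbhd_def by blast

text \<open>The outside neighbour that puts a vertex on the boundary must lie in \<open>X\<close>.
  For finite \<open>X\<close> the boundary is therefore finite, which makes the component a
  region.\<close>

lemma boundary_component:
  assumes "v \<in> verts G - X"
  shows "boundary G (component X v) \<subseteq> nbhd G X"
proof
  fix u assume "u \<in> boundary G (component X v)"
  then obtain w where w: "w \<in> verts G" "w \<notin> component X v" "adjacent G w u"
    and u: "u \<in> component X v"
    using component_subset[OF assms] by (auto simp: boundary_def nbhd_def)
  then have "w \<in> nbhd G (component X v)"
    using adjacent_sym by (fastforce simp: nbhd_def)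
  then show "u \<in> nbhd G X"
    using nbhd_component[OF assms] w u component_subset[OF assms] by (auto simp: nbhd_def)
qed

lemma connected_component:
  assumes "v \<in> verts G - X"
  shows "connected_graph (induced G (component X v))"
proof -
  let ?C = "component X v"
  have path: "(adjacent (induced G ?C))\<^sup>*\<^sup>* v u" if "u \<in> ?C" for u
  proof -
    from that have "(adjacent (induced G (verts G - X)))\<^sup>*\<^sup>* v u" by (simp add: component_def)
    then show ?thesis
    proof (induction rule: rtranclp_induct)
      case (step y z)
      then have "y \<in> ?C" "z \<in> ?C" by (auto simp: component_def)
      with step have "adjacent (induced G ?C) y z" by (simp add: adjacent_induced)
      with step.IH show ?case by simp
    qed simp
  qed
  have "(adjacent (induced G ?C))\<^sup>*\<^sup>* u w" if "u \<in> ?C" "w \<in> ?C" for u w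
    using rtranclp_adjacent_sym[OF path[OF that(1)]] path[OF that(2)] by simp
  moreover have "v \<in> verts (induced G ?C)"
    using assms component_refl by (simp add: induced_def)
  ultimately show ?thesis
    by (auto simp: connected_graph_def induced_def)
qed

lemma region_component:
  assumes "finite X" "v \<in> verts G - X"
  shows "region G (component X v)"
  using assms component_subset connected_component boundary_component finite_nbhd
  unfolding region_def by (meson Diff_subset finite_subset order_trans)

section \<open>Balls, geodesic descent and Koenig's argument\<close>

primrec ball :: "'a set \<Rightarrow> nat \<Rightarrow> 'a set" where
  "ball X 0 = X"
| "ball X (Suc n) = ball X n \<union> nbhd G (ball X n)"

lemma ball_mono: "m \<le> n \<Longrightarrow> ball X m \<subseteq> ball X n"
  by (rule lift_Suc_mono_le[of "ball X"]) auto

lemma finite_ball: "finite X \<Longrightarrow> finite (ball X n)"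
  by (induction n) (auto simp: finite_nbhd)

lemma ball_subset: "X \<subseteq> verts G \<Longrightarrow> ball X n \<subseteq> verts G"
  by (induction n) (auto simp: nbhd_def)

lemma ball_step: "u \<in> ball X n \<Longrightarrow> adjacent G u v \<Longrightarrow> v \<in> ball X (Suc n)"
  using adjacent_verts by (auto simp: nbhd_def)

text \<open>This is the distance from \<open>X\<close>. It is meaningful only on the union of the
  balls; elsewhere \<open>LEAST\<close> has no witness.\<close>

definition level :: "'a set \<Rightarrow> 'a \<Rightarrow> nat" where
  "level X v = (LEAST n. v \<in> ball X n)"

text \<open>These are the edges of geodesics leading away from \<open>X\<close>. The first conjunct
  keeps both levels meaningful.\<close>

definition descends :: "'a set \<Rightarrow> 'a \<Rightarrow> 'a \<Rightarrow> bool" where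
  "descends X u v \<longleftrightarrow> u \<in> (\<Union>n. ball X n) \<and> adjacent G u v \<and> level X v = Suc (level X u)"

lemma mem_ball_iff:
  assumes "v \<in> (\<Union>n. ball X n)"
  shows "v \<in> ball X n \<longleftrightarrow> level X v \<le> n"
proof -
  have "v \<in> ball X (level X v)"
    using assms unfolding level_def by (auto intro: LeastI)
  moreover have "v \<in> ball X n \<Longrightarrow> level X v \<le> n"
    unfolding level_def by (rule Least_le)
  ultimately show ?thesis using ball_mono by blast
qed

lemma descends_closed: "descends X u v \<Longrightarrow> v \<in> (\<Union>n. ball X n)"
  unfolding descends_def by (blast dest: ball_step)

text \<open>Induction on the distance: a vertex at distance \<open>Suc n\<close> has a neighbour in
  \<open>ball X n\<close>, and that neighbour cannot be closer than \<open>n\<close>.\<close>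

lemma descends_from_root:
  assumes "v \<in> (\<Union>n. ball X n)"
  shows "\<exists>u\<in>X. (descends X)\<^sup>*\<^sup>* u v"
  using assms
proof (induction "level X v" arbitrary: v)
  case 0
  then have "v \<in> X" using mem_ball_iff[of v X 0] by simp
  then show ?case by blast
next
  case (Suc n)
  have "v \<in> ball X (Suc n)" "v \<notin> ball X n"
    using Suc mem_ball_iff[OF Suc.prems] by auto
  then obtain u where u: "u \<in> ball X n" "adjacent G u v"
    by (auto simp: nbhd_def)
  then have uK: "u \<in> (\<Union>n. ball X n)" by blast
  have "v \<in> ball X (Suc (level X u))"
    using ball_step u(2) mem_ball_iff[OF uK] by blast
  then have "level X v \<le> Suc (level X u)" using mem_ball_iff[OF Suc.prems] by blast
  moreover have "level X u \<le> n" using mem_ball_iff[OF uK] u(1) by blast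
  ultimately have "level X u = n" using Suc.hyps(2) by linarith
  then have "descends X u v" and "\<exists>w\<in>X. (descends X)\<^sup>*\<^sup>* w u"
    using Suc u uK by (auto simp: descends_def)
  then show ?case by (meson rtranclp.rtrancl_into_rtrancl)
qed

text \<open>Levels only grow along a descent, so a descent that starts outside
  \<open>ball X n\<close> never returns to it.\<close>

lemma descends_in_component:
  assumes "(descends X)\<^sup>*\<^sup>* u v" "u \<in> (\<Union>n. ball X n)" "n < level X u"
  shows "v \<in> component (ball X n) u"
proof -
  have "v \<in> component (ball X n) u \<and> v \<in> (\<Union>n. ball X n) \<and> n < level X v"
    using assms(1)
  proof (induction rule: rtranclp_induct)
    case base
    then show ?case using assms component_refl by simp
  next
    case (step y z)
    then have z: "z \<in> (\<Union>n. ball X n)" "n < level X z"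
      using descends_closed[OF step.hyps(2)] step by (auto simp: descends_def)
    moreover have "z \<in> component (ball X n) u"
    proof (rule component_step)
      show "y \<in> component (ball X n) u" "adjacent G y z"
        using step by (auto simp: descends_def)
      show "y \<notin> ball X n" "z \<notin> ball X n"
        using step z mem_ball_iff[of y X n] mem_ball_iff[of z X n] by auto
    qed
    ultimately show ?case by blast
  qed
  then show ?thesis ..
qed

text \<open>A vertex has finitely many successors by local finiteness, so if infinitely many
  vertices of \<open>Y\<close> lie below it, infinitely many lie below one of its successors. The
  finite set \<open>X\<close> supplies the start in the same way.\<close>

lemma koenig_descent:
  assumes "finite X" "infinite Y" "Y \<subseteq> (\<Union>n. ball X n)"
  obtains f where "f 0 \<in> X" "\<And>n. descends X (f n) (f (Suc n))"
    "\<And>n. infinite {y \<in> Y. (descends X)\<^sup>*\<^sup>* (f n) y}"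
proof -
  let ?D = "\<lambda>u. {y \<in> Y. (descends X)\<^sup>*\<^sup>* u y}"
  have "Y = (\<Union>u\<in>X. ?D u)"
    using assms(3) descends_from_root by blast
  then have "infinite (\<Union>u\<in>X. ?D u)" using assms(2) by simp
  then obtain u where u: "u \<in> X" "infinite (?D u)"
    using assms(1) by auto
  have step: "\<exists>w. infinite (?D w) \<and> descends X v w" if "infinite (?D v)" for v
  proof (rule ccontr)
    assume "\<not> ?thesis"
    then have "finite (\<Union>w\<in>{w. descends X v w}. ?D w)"
      using finite_subset[OF _ finite_neighbours[of v], of "{w. descends X v w}"]
      by (auto simp: descends_def)
    moreover have "?D v \<subseteq> {v} \<union> (\<Union>w\<in>{w. descends X v w}. ?D w)"
      by (auto elim: converse_rtranclpE)
    ultimately show False using that by (meson finite.intros finite_UnI finite_subset)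
  qed
  have "\<exists>f. \<forall>n. (infinite (?D (f n)) \<and> (n = 0 \<longrightarrow> f n \<in> X)) \<and> descends X (f n) (f (Suc n))"
    by (rule dependent_nat_choice) (use u step in blast)+
  then show thesis using that by blast
qed

text \<open>The end is that of a geodesic ray from \<open>koenig_descent\<close>, and
  \<open>C n\<close> is the component of \<open>G - ball X n\<close> containing a tail of it. The
  descendants in \<open>Y\<close> of the ray's vertices make every \<open>C n\<close> meet
  \<open>Y\<close>.\<close>

lemma defining_sequence_of_components:
  assumes X: "finite X" "X \<subseteq> verts G" and Y: "infinite Y" "Y \<subseteq> (\<Union>n. ball X n)"
  shows "\<exists>\<omega>\<in>ends G. \<exists>C. defining_sequence G \<omega> C \<and>
    (\<forall>n. C n \<inter> Y \<noteq> {} \<and> (\<exists>v \<in> (\<Union>n. ball X n) - ball X n. C n = component (ball X n) v))"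
proof -
  let ?K = "\<Union>n. ball X n"
  obtain f where f: "f 0 \<in> X" "\<And>n. descends X (f n) (f (Suc n))"
    "\<And>n. infinite {y \<in> Y. (descends X)\<^sup>*\<^sup>* (f n) y}"
    using koenig_descent[OF X(1) Y] by blast
  have K: "f n \<in> ?K" for n using f(2) by (auto simp: descends_def)
  have KG: "?K \<subseteq> verts G" using ball_subset[OF X(2)] by blast
  have level: "level X (f n) = n" for n
  proof (induction n)
    case 0
    have "f 0 \<in> ball X 0" using f(1) by simp
    then show ?case using mem_ball_iff[OF K] by blast
  next
    case (Suc n)
    then show ?case using f(2) by (simp add: descends_def)
  qed
  have adj: "adjacent G (f n) (f (Suc n))" for n using f(2) by (simp add: descends_def)
  \<comment> \<open>The levels along \<open>f\<close> are 0, 1, 2, and so on, so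
    \<open>level X\<close> is a left inverse of \<open>f\<close> and yields injectivity.\<close>
  have ray: "f \<in> rays G"
    unfolding rays_def using K KG adj level by (auto intro!: inj_on_inverseI[of _ "level X"])
  \<comment> \<open>The vertex \<open>f n\<close> still lies in \<open>ball X n\<close>; the first
    one outside is \<open>f (Suc n)\<close>.\<close>
  define C where "C n = component (ball X n) (f (Suc n))" for n
  have out: "f (Suc n) \<in> ?K - ball X n" for n
    using K mem_ball_iff[OF K, of "Suc n" n] level by simp
  have outG: "f (Suc n) \<in> verts G - ball X n" for n using out KG by blast
  have in_C: "f (i + Suc n) \<in> C n" for i n
  proof (induction i)
    case 0
    then show ?case using component_refl by (simp add: C_def)
  next
    case (Suc i)
    have "f j \<notin> ball X n" if "n < j" for j
      using that mem_ball_iff[OF K] level by simp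
    then show ?case
      using component_step[OF Suc[unfolded C_def] adj] by (simp add: C_def)
  qed
  have dec: "C (Suc n) \<subseteq> C n" for n
  proof -
    have "C (Suc n) \<subseteq> component (ball X n) (f (Suc (Suc n)))"
      unfolding C_def by (rule component_antimono) (rule ball_mono, simp)
    also have "\<dots> = C n"
      using component_eq in_C[of 1 n] unfolding C_def by simp
    finally show ?thesis .
  qed
  \<comment> \<open>\<open>C 0\<close> cannot leave the union of the balls, which is closed under
    adjacency, while each \<open>C n\<close> avoids \<open>ball X n\<close>.\<close>
  have "(\<Inter>n. C n) \<subseteq> {}"
  proof
    fix v assume v: "v \<in> (\<Inter>n. C n)"
    have "v \<in> ?K"
    proof -
      have "v \<in> C 0" using v by blast
      then have "(adjacent (induced G (verts G - X)))\<^sup>*\<^sup>* (f (Suc 0)) v"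
        by (simp add: C_def component_def)
      then show ?thesis
      proof (induction rule: rtranclp_induct)
        case base
        show ?case by (rule K)
      next
        case (step y z)
        then obtain n where "y \<in> ball X n" by blast
        moreover have "adjacent G y z" using step by (simp add: adjacent_induced)
        ultimately have "z \<in> ball X (Suc n)" by (rule ball_step)
        then show ?case by blast
      qed
    qed
    then show "v \<in> {}" using v component_subset[OF outG] unfolding C_def by blast
  qed
  moreover have "\<exists>r\<in>ray_equiv G `` {f}. range r \<subseteq> C n" for n
    using ray_equiv_tail[OF ray, of "Suc n"] in_C[of _ n]
    by (intro bexI[of _ "\<lambda>i. f (i + Suc n)"]) auto
  ultimately have "defining_sequence G (ray_equiv G `` {f}) C"
    unfolding defining_sequence_def
    using dec region_component[OF finite_ball[OF X(1)] outG] by (auto simp: C_def)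
  moreover have "\<forall>n. C n \<inter> Y \<noteq> {} \<and> (\<exists>v \<in> ?K - ball X n. C n = component (ball X n) v)"
  proof (intro allI conjI bexI)
    fix n
    have "{y \<in> Y. (descends X)\<^sup>*\<^sup>* (f (Suc n)) y} \<noteq> {}"
      using f(3) by (metis finite.emptyI)
    then show "C n \<inter> Y \<noteq> {}"
      using descends_in_component[of X "f (Suc n)" _ n] K level unfolding C_def by auto
  qed (rule C_def, rule out)
  moreover have "ray_equiv G `` {f} \<in> ends G"
    using ray by (simp add: ends_def quotientI)
  ultimately show ?thesis by blast
qed

section \<open>Maximal good components\<close>

text \<open>Keeping \<open>P\<close> abstract serves both notions of degree. If infinitely many
  vertices escaped the components satisfying \<open>P\<close>, some end would have a defining
  sequence with no term satisfying \<open>P\<close>, against \<open>no_end\<close>.\<close>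

theorem bad_end_or_good_partition:
  assumes X0: "finite X0" "X0 \<subseteq> verts G"
    and no_end: "\<forall>\<omega>\<in>ends G. \<forall>C. defining_sequence G \<omega> C \<longrightarrow> (\<exists>n. P (C n))"
  obtains X M where "finite X" "X0 \<subseteq> X" "X \<subseteq> verts G" "disjoint M"
    "\<And>C. C \<in> M \<Longrightarrow> P C" "\<And>C. C \<in> M \<Longrightarrow> nbhd G C \<subseteq> X"
    "nbhd G X = (\<Union>C\<in>M. boundary G C)"
proof -
  define K where "K = (\<Union>n. ball X0 n)"
  have KG: "K \<subseteq> verts G" unfolding K_def using ball_subset[OF X0(2)] by blast
  define F where "F = {component (ball X0 n) v | n v.
    v \<in> K - ball X0 n \<and> P (component (ball X0 n) v)}"
  define X where "X = K - \<Union>F"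
  \<comment> \<open>Any vertex of a member of \<open>F\<close> can replace its base point, so two
    members sharing a vertex can be compared through that vertex.\<close>
  have F_mem: "\<exists>n. v \<in> verts G - ball X0 n \<and> C = component (ball X0 n) v" if C: "C \<in> F" and v: "v \<in> C" for C v
  proof -
    obtain n w where w: "w \<in> K - ball X0 n" "C = component (ball X0 n) w"
      using C unfolding F_def by blast
    then have "w \<in> verts G - ball X0 n" using KG by blast
    moreover have "v \<in> component (ball X0 n) w" using w v by blast
    ultimately show ?thesis using component_subset component_eq w(2) by blast
  qed
  have XK: "X \<subseteq> K" unfolding X_def by blast
  have "finite X"
  proof (rule ccontr)
    assume "infinite X"
    then obtain \<omega> C where \<omega>: "\<omega> \<in> ends G" "defining_sequence G \<omega> C"
      and C: "\<And>n. C n \<inter> X \<noteq> {}" "\<And>n. \<exists>v \<in> K - ball X0 n. C n = component (ball X0 n) v"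
      using defining_sequence_of_components[OF X0 _ XK[unfolded K_def], folded K_def] by blast
    obtain n where n: "P (C n)" using no_end \<omega> by blast
    obtain v where "v \<in> K - ball X0 n" "C n = component (ball X0 n) v" using C(2) by blast
    with n have "C n \<in> F" unfolding F_def by (intro CollectI exI[of _ n] exI[of _ v]) simp
    then show False using C(1)[of n] unfolding X_def by blast
  qed
  moreover have "X0 \<subseteq> X"
  proof
    fix v assume v: "v \<in> X0"
    then have "v \<in> ball X0 n" for n using ball_mono[of 0 n X0] by auto
    then show "v \<in> X" using F_mem unfolding X_def K_def by blast
  qed
  moreover have "X \<subseteq> verts G" using KG unfolding X_def by blast
  moreover
  define M where "M = {C \<in> F. \<forall>D\<in>F. C \<subseteq> D \<longrightarrow> D = C}"
  \<comment> \<open>With a common base point, the component belonging to the larger ball is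
    contained in the other.\<close>
  have laminar: "C \<subseteq> D \<or> D \<subseteq> C" if CD: "C \<in> F" "D \<in> F" and v: "v \<in> C" "v \<in> D" for C D v
  proof -
    obtain m n where "C = component (ball X0 m) v" "D = component (ball X0 n) v"
      using F_mem[OF CD(1) v(1)] F_mem[OF CD(2) v(2)] by blast
    then show ?thesis
      using component_antimono[OF ball_mono[of m n X0]] component_antimono[OF ball_mono[of n m X0]]
      by (cases "m \<le> n") auto
  qed
  have "disjoint M"
  proof (rule disjointI, rule ccontr)
    fix C D assume CD: "C \<in> M" "D \<in> M" "C \<noteq> D" and "C \<inter> D \<noteq> {}"
    then obtain v where "v \<in> C" "v \<in> D" by blast
    then have "C \<subseteq> D \<or> D \<subseteq> C" using laminar CD(1,2) by (simp add: M_def)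
    then show False using CD by (auto simp: M_def)
  qed
  moreover have "P C" if "C \<in> M" for C using that by (auto simp: M_def F_def)
  moreover have nbhd_M: "nbhd G C \<subseteq> X" if "C \<in> M" for C
  proof
    fix w assume "w \<in> nbhd G C"
    then obtain u where w: "w \<in> verts G" "w \<notin> C" and u: "u \<in> C" "adjacent G u w"
      by (auto simp: nbhd_def)
    have CF: "C \<in> F" using that by (simp add: M_def)
    obtain n where n: "u \<in> verts G - ball X0 n" "C = component (ball X0 n) u"
      using F_mem[OF CF u(1)] by blast
    have wn: "w \<in> ball X0 n" using component_step[of u] n u w by blast
    have "w \<notin> D" if D: "D \<in> F" for D
    proof
      assume wD: "w \<in> D"
      obtain m where m: "w \<in> verts G - ball X0 m" "D = component (ball X0 m) w"
        using F_mem[OF D wD] by blast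
      \<comment> \<open>Hence \<open>m < n\<close>: \<open>D\<close> comes from the smaller ball, so
        it absorbs \<open>u\<close> and then all of \<open>C\<close>. As \<open>w\<close> is in
        \<open>D\<close> but not in \<open>C\<close>, this contradicts the maximality of
        \<open>C\<close>.\<close>
      have "\<not> n \<le> m" using m(1) wn ball_mono[of n m X0] by blast
      then have sub: "ball X0 m \<subseteq> ball X0 n" by (intro ball_mono) simp
      then have "u \<in> D"
        using component_step[OF component_refl, of w u "ball X0 m"] u(2) m n sub
        by (auto simp: adjacent_sym)
      then have "D = component (ball X0 m) u" using m component_eq by blast
      then have "C \<subseteq> D" using component_antimono[OF sub] n by blast
      then show False using \<open>C \<in> M\<close> D wD w by (auto simp: M_def)
    qed
    then show "w \<in> X" using wn unfolding X_def K_def by blast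
  qed
  moreover have "nbhd G X = (\<Union>C\<in>M. boundary G C)"
  proof (intro equalityI subsetI)
    fix v assume "v \<in> nbhd G X"
    then obtain u where v: "v \<in> verts G" "v \<notin> X" and u: "u \<in> X" "adjacent G u v"
      by (auto simp: nbhd_def)
    have "v \<in> K" using u ball_step unfolding X_def K_def by blast
    then obtain D where D: "D \<in> F" "v \<in> D" using v unfolding X_def by blast
    \<comment> \<open>Smaller balls give larger components, so the least radius at which the
      component of \<open>v\<close> belongs to \<open>F\<close> yields a maximal member containing
      \<open>v\<close>.\<close>
    define Q where "Q n \<longleftrightarrow> v \<notin> ball X0 n \<and> component (ball X0 n) v \<in> F" for n
    have "\<exists>n. Q n" using F_mem[OF D] D unfolding Q_def by auto
    then have Q: "Q (LEAST n. Q n)" by (auto intro: LeastI)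
    define C where "C = component (ball X0 (LEAST n. Q n)) v"
    have CF: "C \<in> F" "v \<in> C" using Q component_refl by (auto simp: Q_def C_def)
    have "C \<in> M"
      unfolding M_def
    proof (intro CollectI conjI ballI impI CF)
      fix E assume E: "E \<in> F" "C \<subseteq> E"
      then obtain n where n: "v \<in> verts G - ball X0 n" "E = component (ball X0 n) v"
        using F_mem CF by blast
      then have "Q n" using E by (auto simp: Q_def)
      then have "ball X0 (LEAST n. Q n) \<subseteq> ball X0 n" by (intro ball_mono Least_le)
      then have "E \<subseteq> C" using component_antimono n unfolding C_def by blast
      then show "E = C" using E by blast
    qed
    \<comment> \<open>Being in \<open>X\<close>, the neighbour \<open>u\<close> of \<open>v\<close>
      lies in no member of \<open>F\<close>, hence outside \<open>C\<close>.\<close>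
    moreover have "v \<in> boundary G C"
      using CF u v adjacent_verts[OF u(2)] unfolding boundary_def nbhd_def X_def by blast
    ultimately show "v \<in> (\<Union>C\<in>M. boundary G C)" by blast
  next
    fix v assume "v \<in> (\<Union>C\<in>M. boundary G C)"
    then obtain C w where C: "C \<in> M" "w \<in> verts G" "w \<notin> C" "adjacent G w v" "v \<in> verts G" "v \<in> C"
      by (auto simp: boundary_def nbhd_def)
    then have "w \<in> nbhd G C"
      using adjacent_sym by (fastforce simp: nbhd_def)
    then have "w \<in> X" using nbhd_M[OF C(1)] by blast
    moreover have "v \<notin> X" using C(1,6) unfolding X_def M_def by blast
    ultimately show "v \<in> nbhd G X" using C by (auto simp: nbhd_def)
  qed
  ultimately show thesis by (rule that)
qed

section \<open>From maximal good components to a finite subgraph of large minimum degree\<close>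

lemma out_degree_le:
  assumes "nbhd G C \<subseteq> X" "boundary G C \<subseteq> nbhd G X"
  shows "degree (out_graph G C) v \<le> degree (induced G (X \<union> nbhd G X)) v"
  unfolding out_graph_def by (rule degree_induced_mono) (use assms in blast)

lemma verts_induced_nbhd: "X \<subseteq> verts G \<Longrightarrow> verts (induced G (X \<union> nbhd G X)) = X \<union> nbhd G X"
  by (auto simp: induced_def nbhd_def)

theorem finite_subgraph_min_degree:
  assumes ne: "verts G \<noteq> {}" and k: "min_degree G \<ge> k"
    and ends: "\<And>\<omega>. \<omega> \<in> ends G \<Longrightarrow> end_min_degree G \<omega> \<ge> ereal (real k)"
  shows "\<exists>H. subgraph H G \<and> finite (verts H) \<and> verts H \<noteq> {} \<and> min_degree H \<ge> k"
proof -
  obtain x where "x \<in> verts G" using ne by blast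
  then have root: "finite {x}" "{x} \<subseteq> verts G" by auto
  \<comment> \<open>The bound is imposed vertex by vertex, so it holds trivially at an empty
    boundary, whatever the infimum over the empty set is.\<close>
  define P where "P C \<longleftrightarrow> (\<forall>v\<in>boundary G C. k \<le> degree (out_graph G C) v)" for C
  have no_end: "\<forall>\<omega>\<in>ends G. \<forall>C. defining_sequence G \<omega> C \<longrightarrow> (\<exists>n. P (C n))"
  proof (intro ballI allI impI, rule ccontr)
    fix \<omega> C assume \<omega>: "\<omega> \<in> ends G" and C: "defining_sequence G \<omega> C"
    assume notP: "\<nexists>n. P (C n)"
    \<comment> \<open>Degrees are integers, so a failure of \<open>P\<close> costs at least 1. This
      gap survives in the limit, whereas a bare \<open>< k\<close> would not.\<close>
    have "ereal (real (min_out_degree G (C n))) \<le> ereal (real k - 1)" for n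
    proof -
      obtain v where v: "v \<in> boundary G (C n)" "degree (out_graph G (C n)) v < k"
        using notP unfolding P_def by (meson not_le)
      have "min_out_degree G (C n) \<le> degree (out_graph G (C n)) v"
        unfolding min_out_degree_def by (rule cINF_lower) (use v in auto)
      then show ?thesis using v(2) by auto
    qed
    from Inf_limits_le[where f = "\<lambda>C. ereal (real (min_out_degree G C))", OF C this]
    have "end_min_degree G \<omega> \<le> ereal (real k - 1)" by (simp add: end_min_degree_def)
    from order_trans[OF ends[OF \<omega>] this] show False by simp
  qed
  obtain X M where X: "finite X" "{x} \<subseteq> X" "X \<subseteq> verts G" and disj: "disjoint M"
    and M: "\<And>C. C \<in> M \<Longrightarrow> P C" "\<And>C. C \<in> M \<Longrightarrow> nbhd G C \<subseteq> X" "nbhd G X = (\<Union>C\<in>M. boundary G C)"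
    using bad_end_or_good_partition[OF root no_end] by blast
  let ?H = "induced G (X \<union> nbhd G X)"
  have "k \<le> degree ?H v" if v: "v \<in> X \<union> nbhd G X" for v
  proof (cases "v \<in> X")
    case True
    have "min_degree G \<le> degree G v"
      unfolding min_degree_def by (rule cINF_lower) (use True X in auto)
    then show ?thesis using k degree_induced_nbhd[OF True] by simp
  next
    case False
    then obtain C where C: "C \<in> M" "v \<in> boundary G C" using v M(3) by blast
    then have "k \<le> degree (out_graph G C) v" using M(1) unfolding P_def by blast
    also have "\<dots> \<le> degree ?H v" by (rule out_degree_le) (use C M in blast)+
    finally show ?thesis .
  qed
  then have "k \<le> min_degree ?H"
    unfolding min_degree_def verts_induced_nbhd[OF X(3)] using X(2) by (intro cINF_greatest) auto
  moreover have "finite (verts ?H)" "verts ?H \<noteq> {}"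
    using X verts_induced_nbhd finite_nbhd by auto
  ultimately show ?thesis using subgraph_induced[OF simple] by blast
qed

section \<open>From maximal good components to a finite subgraph of large average degree\<close>

theorem finite_subgraph_avg_degree:
  fixes q :: real
  assumes ends_ne: "ends G \<noteq> {}" and S0: "finite S0" "S0 \<subseteq> verts G"
    and avg: "\<And>S. finite S \<Longrightarrow> S \<subseteq> verts G \<Longrightarrow> S0 \<subseteq> S \<Longrightarrow> S \<noteq> {} \<Longrightarrow> avg_degree G S \<ge> q"
    and ends: "\<And>\<omega>. \<omega> \<in> ends G \<Longrightarrow> end_avg_degree G \<omega> > ereal q"
  shows "\<exists>H. subgraph H G \<and> finite (verts H) \<and> verts H \<noteq> {} \<and> avg_degree H (verts H) > q"
proof -
  \<comment> \<open>The start of this ray joins \<open>S0\<close> in the root set, so that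
    \<open>X\<close> is nonempty and the ray has to leave it.\<close>
  obtain r where r: "r \<in> rays G"
    using ends_ne by (auto simp: ends_def quotient_def)
  define P where "P C \<longleftrightarrow> q < avg_out_degree G C" for C
  have no_end: "\<forall>\<omega>\<in>ends G. \<forall>C. defining_sequence G \<omega> C \<longrightarrow> (\<exists>n. P (C n))"
  proof (intro ballI allI impI, rule ccontr)
    fix \<omega> C assume \<omega>: "\<omega> \<in> ends G" and C: "defining_sequence G \<omega> C"
    assume "\<nexists>n. P (C n)"
    then have "ereal (avg_out_degree G (C n)) \<le> ereal q" for n
      unfolding P_def by (simp add: not_less)
    \<comment> \<open>A weak bound suffices in the limit, since the hypothesis on the ends is
      strict.\<close>
    from Inf_limits_le[where f = "\<lambda>C. ereal (avg_out_degree G C)", OF C this]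
    have "end_avg_degree G \<omega> \<le> ereal q" by (simp add: end_avg_degree_def)
    with ends[OF \<omega>] show False by simp
  qed
  have root: "finite (insert (r 0) S0)" "insert (r 0) S0 \<subseteq> verts G"
    using r S0 by (auto simp: rays_def)
  obtain X M where X: "finite X" "insert (r 0) S0 \<subseteq> X" "X \<subseteq> verts G" and disj: "disjoint M"
    and M: "\<And>C. C \<in> M \<Longrightarrow> P C" "\<And>C. C \<in> M \<Longrightarrow> nbhd G C \<subseteq> X" "nbhd G X = (\<Union>C\<in>M. boundary G C)"
    using bad_end_or_good_partition[OF root no_end] by blast
  let ?N = "nbhd G X" and ?H = "induced G (X \<union> nbhd G X)"
  have finN: "finite ?N" using finite_nbhd X by blast
  \<comment> \<open>On \<open>X\<close> the average is only known to be at least \<open>q\<close>;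
    the strict excess comes from the neighbourhood, which must therefore be nonempty.\<close>
  have N_ne: "?N \<noteq> {}"
  proof
    assume "?N = {}"
    have "r n \<in> X" for n
    proof (induction n)
      case 0
      then show ?case using X by simp
    next
      case (Suc n)
      have "adjacent G (r n) (r (Suc n))" "r (Suc n) \<in> verts G" using r by (auto simp: rays_def)
      then show ?case using \<open>?N = {}\<close> Suc unfolding nbhd_def by blast
    qed
    moreover have "infinite (range r)" using r by (simp add: rays_def range_inj_infinite)
    ultimately show False using X(1) by (meson finite_subset image_subsetI)
  qed
  have "q * card X \<le> (\<Sum>v\<in>X. real (degree G v))"
  proof -
    have "q \<le> avg_degree G X" using avg[of X] X by auto
    moreover have "card X > 0" using X by (auto simp: card_gt_0_iff)
    ultimately show ?thesis by (simp add: avg_degree_def field_simps)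
  qed
  also have "\<dots> = (\<Sum>v\<in>X. real (degree ?H v))"
    by (simp add: degree_induced_nbhd)
  finally have sumX: "q * card X \<le> (\<Sum>v\<in>X. real (degree ?H v))" .
  have "(\<Sum>v\<in>?N. q) < (\<Sum>v\<in>?N. real (degree ?H v))"
  proof -
    \<comment> \<open>The empty set is removed because an empty boundary has average
      \<open>0 / 0 = 0\<close>, which exceeds a negative \<open>q\<close>, while the strict
      inequality of sums fails on it.\<close>
    define B where "B = boundary G ` M - {{}}"
    have UB: "\<Union>B = ?N" using M(3) unfolding B_def by auto
    have finB: "finite B" "\<And>A. A \<in> B \<Longrightarrow> finite A"
      using finN UB by (auto intro: finite_UnionD finite_subset)
    have disjB: "\<forall>A\<in>B. \<forall>A'\<in>B. A \<noteq> A' \<longrightarrow> A \<inter> A' = {}"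
    proof (intro ballI impI)
      fix A A' assume "A \<in> B" "A' \<in> B" "A \<noteq> A'"
      then obtain C C' where "C \<in> M" "C' \<in> M" "C \<noteq> C'" "A = boundary G C" "A' = boundary G C'"
        unfolding B_def by blast
      moreover from this have "C \<inter> C' = {}" using disj by (simp add: disjointD)
      ultimately show "A \<inter> A' = {}"
        using boundary_subset[of G C] boundary_subset[of G C'] by blast
    qed
    have less: "(\<Sum>v\<in>A. q) < (\<Sum>v\<in>A. real (degree ?H v))" if "A \<in> B" for A
    proof -
      obtain C where C: "C \<in> M" "A = boundary G C" "A \<noteq> {}" using \<open>A \<in> B\<close> unfolding B_def by blast
      have "card A > 0" using C(3) finB(2)[OF that] by (simp add: card_gt_0_iff)
      moreover have "q < avg_degree (out_graph G C) A"
        using M(1)[OF C(1)] C(2) by (simp add: P_def avg_out_degree_def)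
      ultimately have "(\<Sum>v\<in>A. q) < (\<Sum>v\<in>A. real (degree (out_graph G C) v))"
        by (simp add: avg_degree_def field_simps)
      also have "\<dots> \<le> (\<Sum>v\<in>A. real (degree ?H v))"
        using C M by (intro sum_mono of_nat_mono out_degree_le) blast+
      finally show ?thesis .
    qed
    have "(\<Sum>A\<in>B. \<Sum>v\<in>A. q) < (\<Sum>A\<in>B. \<Sum>v\<in>A. real (degree ?H v))"
      by (rule sum_strict_mono) (use finB(1) N_ne UB less in blast)+
    then show ?thesis
      using sum.Union_disjoint[OF _ disjB] finB(2) unfolding UB comp_def by (metis (no_types, lifting))
  qed
  moreover have "X \<inter> ?N = {}" by (auto simp: nbhd_def)
  ultimately have "q * card (X \<union> ?N) < (\<Sum>v\<in>X \<union> ?N. real (degree ?H v))"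
    using sumX X(1) finN by (simp add: sum.union_disjoint card_Un_disjoint algebra_simps)
  moreover have "card (X \<union> ?N) > 0" using X finN by (auto simp: card_gt_0_iff)
  ultimately have "q < avg_degree ?H (verts ?H)"
    unfolding verts_induced_nbhd[OF X(3)] avg_degree_def by (simp add: field_simps)
  moreover have "finite (verts ?H)" "verts ?H \<noteq> {}"
    using X verts_induced_nbhd finN by auto
  ultimately show ?thesis using subgraph_induced[OF simple] by blast
qed

end

theorem theorem1:
  fixes G :: "'a graph" and k :: nat and q :: rat
  assumes "simple_graph G" and "locally_finite G" and "infinite (verts G)"
  shows
    "(min_degree G \<ge> k \<and> (\<forall>\<omega>\<in>ends G. end_min_degree G \<omega> \<ge> ereal (real k))
        \<longrightarrow> (\<exists>H. subgraph H G \<and> finite (verts H) \<and> verts H \<noteq> {} \<and> min_degree H \<ge> k))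
     \<and> (ends G \<noteq> {}
        \<and> (\<exists>S\<^sub>0. finite S\<^sub>0 \<and> S\<^sub>0 \<subseteq> verts G \<and>
              (\<forall>S. finite S \<and> S \<subseteq> verts G \<and> S\<^sub>0 \<subseteq> S \<and> S \<noteq> {} \<longrightarrow> avg_degree G S \<ge> real_of_rat q))
        \<and> (\<forall>\<omega>\<in>ends G. end_avg_degree G \<omega> > ereal (real_of_rat q))
        \<longrightarrow> (\<exists>H. subgraph H G \<and> finite (verts H) \<and> verts H \<noteq> {} \<and>
              avg_degree H (verts H) > real_of_rat q))"
proof -
  interpret locally_finite_graph G
    by unfold_locales (use assms in auto)
  have "verts G \<noteq> {}" using assms(3) by auto
  then show ?thesis
    using finite_subgraph_min_degree[of k] finite_subgraph_avg_degree[of _ "real_of_rat q"]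
    by (intro conjI impI) (blast, metis)
qed

end
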